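(* Let $\mathbf{e}_1,\mathbf{e}_2,\mathbf{e}_3$ be a left invariant frame on $\mathrm{E}(1,1)$ with non-zero brackets $[\mathbf{e}_2,\mathbf{e}_3]=\mathbf{e}_1$ and $[\mathbf{e}_1,\mathbf{e}_2]=-\mathbf{e}_3$, with dual coframe $\omega^1,\omega^2,\omega^3$, and let $A,B>0$. The left invariant metric $\mathbf{g}=A\,\omega^{1}\otimes\omega^{1}+B\,\omega^{2}\otimes\omega^{2}+\omega^{3}\otimes\omega^{3}$ is an expanding (respectively shrinking) algebraic soliton, with soliton constant $\kappa$, for the $+\mathrm{XCF}$ (respectively $-\mathrm{XCF}$) if and only if $A=1$ and the soliton constant is $\kappa=\frac{1}{B^{2}}$ (respectively $\kappa=-\frac{1}{B^{2}}$).
   Context: $\mathrm{E}(1,1)$ is the simply connected solvable three-dimensional Lie group of isometries of the Lorentz–Minkowski plane, whose Lie algebra $\mathfrak{h}$ has a basis with the stated brackets, $[\mathbf{e}_3,\mathbf{e}_1]=0$. Cross curvature tensor: for a Riemannian metric $\mathbf{g}$ on a three-manifold with Ricci tensor $R_{ij}$ and scalar curvature $S$, put $P^{ij}=g^{ik}g^{jl}R_{kl}-\frac{S}{2}g^{ij}$. When $(P^{ij})$ is invertible with inverse $(V_{ij})$, the cross curvature tensor $\mathbf{H}[\mathbf{g}]$ has components $H_{ij}=\frac{\det P^{kl}}{\det g^{kl}}V_{ij}$. Equivalently, and also when $P$ is not invertible, in a local orthonormal frame $\mathbf{f}_1,\mathbf{f}_2,\mathbf{f}_3$ diagonalizing the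 Ricci tensor, $\mathbf{H}$ is diagonal with $H_{ll}=K_mK_n$ for $(l,m,n)$ any permutation of $(1,2,3)$, where $K_l$ is the sectional curvature of the plane spanned by $\mathbf{f}_m,\mathbf{f}_n$. The $\pm\mathrm{XCF}$ is $\frac{\partial\mathbf{g}}{\partial t}=\pm2\mathbf{H}[\mathbf{g}]$. For algebraic solitons (and their soliton constants) of $\pm\mathrm{XCF}$ the convention is to use $\mathbf{T}=\pm\mathbf{H}$, not $\pm2\mathbf{H}$. The operator $\widehat{\mathbf{T}[\mathbf{g}]}:\mathfrak{h}\to\mathfrak{h}$ is defined by $\mathbf{g}(\widehat{\mathbf{T}[\mathbf{g}]}(X),Y)=\mathbf{T}[\mathbf{g}](X,Y)$. A left invariant metric $\mathbf{g}$ is an algebraic $\mathbf{T}$-soliton with soliton constant $\kappa\in\mathbb{R}$ if $\widehat{\mathbf{T}[\mathbf{g}]}-\kappa\,\mathrm{Id}$ is a derivation of $\mathfrak{h}$; it is expanding if $\kappa>0$ and shrinking if $\kappa<0$. *)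

theory Defs
  imports "HOL-Analysis.Analysis"
begin

section \<open>Riemannian geometry in a global chart\<close>

text \<open>
  The underlying manifold is always \<^typ>\<open>real^'n\<close> with its standard global chart. A covariant
  2-tensor field maps a point and two tangent vectors at that point to a real number.
\<close>

type_synonym 'n vector_field = "real^'n \<Rightarrow> real^'n"
type_synonym 'n tensor2 = "real^'n \<Rightarrow> real^'n \<Rightarrow> real^'n \<Rightarrow> real"

definition lie_bracket :: "'n::finite vector_field \<Rightarrow> 'n vector_field \<Rightarrow> 'n vector_field" where
  "lie_bracket X Y p =
     frechet_derivative Y (at p) (X p) - frechet_derivative X (at p) (Y p)"

definition partial_deriv :: "'n::finite \<Rightarrow> (real^'n \<Rightarrow> real) \<Rightarrow> real^'n \<Rightarrow> real" where
  "partial_deriv i f p = frechet_derivative f (at p) (axis i 1)"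

definition components :: "'n::finite tensor2 \<Rightarrow> real^'n \<Rightarrow> real^'n^'n" where
  "components T p = (\<chi> i j. T p (axis i 1) (axis j 1))"

text \<open>No smoothness in the base point is demanded here; it is automatic for left invariant metrics
  on a Lie group, the only ones to which this is applied.\<close>
definition riemannian_metric :: "'n::finite tensor2 \<Rightarrow> bool" where
  "riemannian_metric g \<longleftrightarrow>
     (\<forall>p. bilinear (g p) \<and> (\<forall>u v. g p u v = g p v u) \<and> (\<forall>u. u \<noteq> 0 \<longrightarrow> g p u u > 0))"

abbreviation inverse_metric :: "'n::finite tensor2 \<Rightarrow> real^'n \<Rightarrow> real^'n^'n" where
  "inverse_metric g p \<equiv> matrix_inv (components g p)"

text \<open>\<open>christoffel g k i j\<close> is \<open>\<Gamma>\<^sup>k\<^sub>i\<^sub>j\<close>, the symbol of the Levi-Civita connection.\<close>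
definition christoffel :: "'n::finite tensor2 \<Rightarrow> 'n \<Rightarrow> 'n \<Rightarrow> 'n \<Rightarrow> real^'n \<Rightarrow> real" where
  "christoffel g k i j p =
     (1/2) * (\<Sum>l\<in>UNIV. inverse_metric g p $ k $ l *
       (partial_deriv i (\<lambda>q. components g q $ j $ l) p
        + partial_deriv j (\<lambda>q. components g q $ i $ l) p
        - partial_deriv l (\<lambda>q. components g q $ i $ j) p))"

text \<open>\<open>curvature_comp g l i j k\<close> is the coefficient of \<open>\<partial>\<^sub>l\<close> in \<open>R(\<partial>\<^sub>i, \<partial>\<^sub>j)\<partial>\<^sub>k\<close>, where
  \<open>R(X,Y)Z = \<nabla>\<^sub>X\<nabla>\<^sub>Y Z - \<nabla>\<^sub>Y\<nabla>\<^sub>X Z - \<nabla>\<^bsub>[X,Y]\<^esub> Z\<close>.\<close>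
definition curvature_comp :: "'n::finite tensor2 \<Rightarrow> 'n \<Rightarrow> 'n \<Rightarrow> 'n \<Rightarrow> 'n \<Rightarrow> real^'n \<Rightarrow> real" where
  "curvature_comp g l i j k p =
     partial_deriv i (christoffel g l j k) p - partial_deriv j (christoffel g l i k) p
     + (\<Sum>m\<in>UNIV. christoffel g l i m p * christoffel g m j k p
                 - christoffel g l j m p * christoffel g m i k p)"

definition curvature :: "'n::finite tensor2 \<Rightarrow> real^'n \<Rightarrow> real^'n \<Rightarrow> real^'n \<Rightarrow> real^'n \<Rightarrow> real^'n" where
  "curvature g p u v w =
     (\<chi> l. \<Sum>i\<in>UNIV. \<Sum>j\<in>UNIV. \<Sum>k\<in>UNIV. curvature_comp g l i j k p * u $ i * v $ j * w $ k)"

definition sectional_curvature :: "'n::finite tensor2 \<Rightarrow> real^'n \<Rightarrow> real^'n \<Rightarrow> real^'n \<Rightarrow> real" where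
  "sectional_curvature g p u v =
     g p (curvature g p u v v) u / (g p u u * g p v v - (g p u v)\<^sup>2)"

definition ricci :: "'n::finite tensor2 \<Rightarrow> 'n tensor2" where
  "ricci g p u v = (\<Sum>i\<in>UNIV. curvature g p (axis i 1) u v $ i)"

definition scalar_curvature :: "'n::finite tensor2 \<Rightarrow> real^'n \<Rightarrow> real" where
  "scalar_curvature g p =
     (\<Sum>i\<in>UNIV. \<Sum>j\<in>UNIV. inverse_metric g p $ i $ j * components (ricci g) p $ i $ j)"

section \<open>The cross curvature tensor of a three-manifold\<close>

definition cross_P :: "3 tensor2 \<Rightarrow> real^3 \<Rightarrow> real^3^3" where
  "cross_P g p = (\<chi> i j.
     (\<Sum>k\<in>UNIV. \<Sum>l\<in>UNIV. inverse_metric g p $ i $ k * inverse_metric g p $ j $ l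
                          * components (ricci g) p $ k $ l)
     - scalar_curvature g p / 2 * inverse_metric g p $ i $ j)"

definition ricci_frame :: "3 tensor2 \<Rightarrow> real^3 \<Rightarrow> (3 \<Rightarrow> real^3) \<Rightarrow> bool" where
  "ricci_frame g p f \<longleftrightarrow>
     (\<forall>i j. g p (f i) (f j) = (if i = j then 1 else 0)) \<and>
     (\<forall>i j. i \<noteq> j \<longrightarrow> ricci g p (f i) (f j) = 0)"

text \<open>Arithmetic in the index type \<^typ>\<open>3\<close> is modulo 3, so \<open>l, l + 1, l + 2\<close> are always the three
  distinct indices.\<close>
definition frame_sectional :: "3 tensor2 \<Rightarrow> real^3 \<Rightarrow> (3 \<Rightarrow> real^3) \<Rightarrow> 3 \<Rightarrow> real" where
  "frame_sectional g p f l = sectional_curvature g p (f (l + 1)) (f (l + 2))"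

text \<open>Where \<open>P\<close> is invertible, \<open>H\<^sub>i\<^sub>j = (det P\<^sup>k\<^sup>l / det g\<^sup>k\<^sup>l) V\<^sub>i\<^sub>j\<close> with \<open>V\<close> the inverse of \<open>P\<close>. Elsewhere
  \<open>H\<close> is the bilinear form with \<open>H(f\<^sub>l, f\<^sub>l) = K\<^sub>m K\<^sub>n\<close> and \<open>H(f\<^sub>l, f\<^sub>m) = 0\<close> in an orthonormal frame
  \<open>f\<close> diagonalizing the Ricci tensor; it does not depend on the choice of \<open>f\<close>.\<close>
definition cross_curvature :: "3 tensor2 \<Rightarrow> 3 tensor2" where
  "cross_curvature g p u v =
     (if invertible (cross_P g p)
      then \<Sum>i\<in>UNIV. \<Sum>j\<in>UNIV.
             det (cross_P g p) / det (inverse_metric g p) * matrix_inv (cross_P g p) $ i $ j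
             * u $ i * v $ j
      else let f = (SOME f. ricci_frame g p f) in
             \<Sum>l\<in>UNIV. frame_sectional g p f (l + 1) * frame_sectional g p f (l + 2)
                        * g p u (f l) * g p v (f l))"

section \<open>Left invariant objects and algebraic solitons\<close>

text \<open>\<open>mul\<close> is the multiplication of a Lie group with underlying manifold \<^typ>\<open>real^'n\<close>.\<close>

definition left_invariant_field ::
  "(real^'n \<Rightarrow> real^'n \<Rightarrow> real^'n) \<Rightarrow> 'n::finite vector_field \<Rightarrow> bool" where
  "left_invariant_field mul X \<longleftrightarrow>
     (\<forall>p q. X (mul p q) = frechet_derivative (mul p) (at q) (X q))"

definition lie_algebra :: "(real^'n \<Rightarrow> real^'n \<Rightarrow> real^'n) \<Rightarrow> 'n::finite vector_field set" where
  "lie_algebra mul = {X. left_invariant_field mul X}"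

definition left_invariant_metric ::
  "(real^'n \<Rightarrow> real^'n \<Rightarrow> real^'n) \<Rightarrow> 'n::finite tensor2 \<Rightarrow> bool" where
  "left_invariant_metric mul g \<longleftrightarrow>
     riemannian_metric g \<and>
     (\<forall>p q u v. g (mul p q) (frechet_derivative (mul p) (at q) u)
                            (frechet_derivative (mul p) (at q) v) = g q u v)"

definition left_invariant_frame ::
  "(real^'n \<Rightarrow> real^'n \<Rightarrow> real^'n) \<Rightarrow> ('n \<Rightarrow> 'n::finite vector_field) \<Rightarrow> bool" where
  "left_invariant_frame mul e \<longleftrightarrow>
     (\<forall>i. e i \<in> lie_algebra mul) \<and>
     (\<forall>p. inj (\<lambda>i. e i p) \<and> independent (range (\<lambda>i. e i p)))"

definition dual_coframe ::
  "('n \<Rightarrow> 'n::finite vector_field) \<Rightarrow> ('n \<Rightarrow> real^'n \<Rightarrow> real^'n \<Rightarrow> real) \<Rightarrow> bool" where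
  "dual_coframe e \<omega> \<longleftrightarrow>
     (\<forall>i p. linear (\<omega> i p)) \<and> (\<forall>i j p. \<omega> i p (e j p) = (if i = j then 1 else 0))"

definition derivation ::
  "(real^'n \<Rightarrow> real^'n \<Rightarrow> real^'n) \<Rightarrow> ('n::finite vector_field \<Rightarrow> 'n vector_field) \<Rightarrow> bool" where
  "derivation mul D \<longleftrightarrow>
     (\<forall>X\<in>lie_algebra mul. D X \<in> lie_algebra mul) \<and>
     (\<forall>X\<in>lie_algebra mul. \<forall>Y\<in>lie_algebra mul. \<forall>a b.
        D (\<lambda>p. a *\<^sub>R X p + b *\<^sub>R Y p) = (\<lambda>p. a *\<^sub>R D X p + b *\<^sub>R D Y p)) \<and>
     (\<forall>X\<in>lie_algebra mul. \<forall>Y\<in>lie_algebra mul.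
        D (lie_bracket X Y) = (\<lambda>p. lie_bracket (D X) Y p + lie_bracket X (D Y) p))"

definition metric_endomorphism ::
  "'n::finite tensor2 \<Rightarrow> 'n tensor2 \<Rightarrow> 'n vector_field \<Rightarrow> 'n vector_field" where
  "metric_endomorphism g T X p = (THE w. \<forall>y. g p w y = T p (X p) y)"

definition algebraic_soliton ::
  "(real^'n \<Rightarrow> real^'n \<Rightarrow> real^'n) \<Rightarrow> ('n::finite tensor2 \<Rightarrow> 'n tensor2) \<Rightarrow> 'n tensor2 \<Rightarrow> real \<Rightarrow> bool"
where
  "algebraic_soliton mul T g \<kappa> \<longleftrightarrow>
     left_invariant_metric mul g \<and>
     derivation mul (\<lambda>X p. metric_endomorphism g (T g) X p - \<kappa> *\<^sub>R X p)"

definition expanding_algebraic_soliton ::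
  "(real^'n \<Rightarrow> real^'n \<Rightarrow> real^'n) \<Rightarrow> ('n::finite tensor2 \<Rightarrow> 'n tensor2) \<Rightarrow> 'n tensor2 \<Rightarrow> real \<Rightarrow> bool"
where
  "expanding_algebraic_soliton mul T g \<kappa> \<longleftrightarrow> algebraic_soliton mul T g \<kappa> \<and> \<kappa> > 0"

definition shrinking_algebraic_soliton ::
  "(real^'n \<Rightarrow> real^'n \<Rightarrow> real^'n) \<Rightarrow> ('n::finite tensor2 \<Rightarrow> 'n tensor2) \<Rightarrow> 'n tensor2 \<Rightarrow> real \<Rightarrow> bool"
where
  "shrinking_algebraic_soliton mul T g \<kappa> \<longleftrightarrow> algebraic_soliton mul T g \<kappa> \<and> \<kappa> < 0"

text \<open>The flows are \<open>\<partial>g/\<partial>t = \<plusminus>2H[g]\<close>, but their solitons are by convention those of \<open>T = \<plusminus>H\<close>, without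
  the factor 2.\<close>

definition plus_XCF_tensor :: "3 tensor2 \<Rightarrow> 3 tensor2" where
  "plus_XCF_tensor g = cross_curvature g"

definition minus_XCF_tensor :: "3 tensor2 \<Rightarrow> 3 tensor2" where
  "minus_XCF_tensor g = (\<lambda>p u v. - cross_curvature g p u v)"

section \<open>The group E(1,1)\<close>

text \<open>The point \<open>(x, y, s)\<close> of \<^typ>\<open>real^3\<close> stands for the isometry of the Lorentz-Minkowski plane
  consisting of the boost of rapidity \<open>s\<close> followed by the translation by \<open>(x, y)\<close>; the
  multiplication is composition of isometries.\<close>

definition e11_act :: "real^3 \<Rightarrow> real^2 \<Rightarrow> real^2" where
  "e11_act p z = vector [p$1 + cosh (p$3) * z$1 + sinh (p$3) * z$2,
                         p$2 + sinh (p$3) * z$1 + cosh (p$3) * z$2]"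

definition e11_mult :: "real^3 \<Rightarrow> real^3 \<Rightarrow> real^3" where
  "e11_mult p q = vector [p$1 + cosh (p$3) * q$1 + sinh (p$3) * q$2,
                          p$2 + sinh (p$3) * q$1 + cosh (p$3) * q$2,
                          p$3 + q$3]"

lemma e11_act_mult: "e11_act (e11_mult p q) z = e11_act p (e11_act q z)"
  by (simp add: e11_act_def e11_mult_def vec_eq_iff forall_2 cosh_add sinh_add algebra_simps)

lemma e11_act_isometry:
  "(e11_act p z $ 1 - e11_act p w $ 1)\<^sup>2 - (e11_act p z $ 2 - e11_act p w $ 2)\<^sup>2
   = (z$1 - w$1)\<^sup>2 - (z$2 - w$2)\<^sup>2"
proof -
  define a b where "a = z$1 - w$1" and "b = z$2 - w$2"
  have "(e11_act p z $ 1 - e11_act p w $ 1)\<^sup>2 - (e11_act p z $ 2 - e11_act p w $ 2)\<^sup>2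
      = (cosh (p$3) * a + sinh (p$3) * b)\<^sup>2 - (sinh (p$3) * a + cosh (p$3) * b)\<^sup>2"
    by (simp add: e11_act_def a_def b_def algebra_simps)
  also have "\<dots> = ((cosh (p$3))\<^sup>2 - (sinh (p$3))\<^sup>2) * (a\<^sup>2 - b\<^sup>2)"
    by algebra
  finally show ?thesis
    by (simp add: hyperbolic_pythagoras a_def b_def)
qed

lemma inj_e11_act: "inj e11_act"
proof (rule injI)
  fix p q assume eq: "e11_act p = e11_act q"
  have "e11_act p 0 = e11_act q 0" "e11_act p (axis 1 1) = e11_act q (axis 1 1)"
    using eq by simp_all
  then show "p = q"
    by (simp add: e11_act_def vec_eq_iff forall_2 forall_3 axis_def)
qed

lemma e11_mult_assoc: "e11_mult (e11_mult p q) r = e11_mult p (e11_mult q r)"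
  by (rule injD[OF inj_e11_act]) (simp add: fun_eq_iff e11_act_mult)

lemma e11_mult_zero [simp]: "e11_mult 0 p = p" "e11_mult p 0 = p"
  by (simp_all add: e11_mult_def vec_eq_iff forall_3)

lemma e11_mult_inverse: "\<exists>q. e11_mult p q = 0 \<and> e11_mult q p = 0"
proof -
  have 1: "cosh (p$3) * cosh (p$3) = 1 + sinh (p$3) * sinh (p$3)"
    using hyperbolic_pythagoras[of "p$3"] by (simp add: power2_eq_square)
  have 2: "a + a * (sinh (p$3) * sinh (p$3)) = a * (cosh (p$3) * cosh (p$3))" for a
    by (simp add: 1 algebra_simps)
  show ?thesis
    by (rule exI[of _ "vector [- cosh (p$3) * p$1 + sinh (p$3) * p$2,
                               sinh (p$3) * p$1 - cosh (p$3) * p$2, - p$3]"])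
      (simp add: e11_mult_def vec_eq_iff forall_3 algebra_simps 2)
qed

text \<open>Left invariant frames with the prescribed brackets exist; \<open>e11_frame\<close> is one.\<close>

definition e11_frame :: "3 \<Rightarrow> 3 vector_field" where
  "e11_frame i p =
     (if i = 1 then vector [sinh (p$3), cosh (p$3), 0]
      else if i = 2 then vector [0, 0, 1]
      else vector [cosh (p$3), sinh (p$3), 0])"

lemma vec3_eq: "(vector [a, b, c] :: real^3) = a *\<^sub>R axis 1 1 + b *\<^sub>R axis 2 1 + c *\<^sub>R axis 3 1"
  by (simp add: vec_eq_iff forall_3 axis_def)

lemma has_derivative_e11_frame:
  "(e11_frame i has_derivative (\<lambda>h. h$3 *\<^sub>R (if i = 2 then 0 else e11_frame (4 - i) p))) (at p)"
proof -
  have L: "((\<lambda>p::real^3. p$3) has_derivative (\<lambda>h. h$3)) (at p)"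
    by (intro bounded_linear_imp_has_derivative bounded_linear_vec_nth)
  have s: "((\<lambda>p::real^3. sinh (p$3)) has_derivative (\<lambda>h. h$3 * cosh (p$3))) (at p)"
    using DERIV_compose_FDERIV[OF has_field_derivative_sinh[OF DERIV_ident] L] by simp
  have c: "((\<lambda>p::real^3. cosh (p$3)) has_derivative (\<lambda>h. h$3 * sinh (p$3))) (at p)"
    using DERIV_compose_FDERIV[OF has_field_derivative_cosh[OF DERIV_ident] L] by simp
  consider "i = 1" | "i = 2" | "i = 3" using exhaust_3 by blast
  then show ?thesis
  proof cases
    case 1
    show ?thesis unfolding 1 e11_frame_def vec3_eq
      by (auto intro!: derivative_eq_intros s c simp: vec_eq_iff forall_3 axis_def)
  next
    case 2
    then show ?thesis unfolding e11_frame_def by simp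
  next
    case 3
    show ?thesis unfolding 3 e11_frame_def vec3_eq
      by (auto intro!: derivative_eq_intros s c simp: vec_eq_iff forall_3 axis_def)
  qed
qed

lemma has_derivative_e11_mult:
  "(e11_mult p has_derivative (\<lambda>h. e11_mult (vector [0, 0, p$3]) h - vector [0, 0, p$3])) (at q)"
proof -
  define f where "f = (\<lambda>h. e11_mult (vector [0, 0, p$3]) h - vector [0, 0, p$3] :: real^3)"
  have "linear f"
    by (rule linearI) (simp_all add: f_def e11_mult_def vec_eq_iff forall_3 algebra_simps)
  then have "(f has_derivative f) (at q)"
    by (intro bounded_linear_imp_has_derivative) (simp add: linear_conv_bounded_linear)
  then have "((\<lambda>h. p + f h) has_derivative f) (at q)"
    by (auto intro!: derivative_eq_intros)
  moreover have "e11_mult p = (\<lambda>h. p + f h)"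
    by (simp add: fun_eq_iff f_def e11_mult_def vec_eq_iff forall_3)
  ultimately show ?thesis unfolding f_def by simp
qed

lemma e11_frame:
  "left_invariant_frame e11_mult e11_frame"
  "lie_bracket (e11_frame 2) (e11_frame 3) = e11_frame 1"
  "lie_bracket (e11_frame 1) (e11_frame 2) = (\<lambda>p. - e11_frame 3 p)"
  "lie_bracket (e11_frame 3) (e11_frame 1) = (\<lambda>p. 0)"
proof -
  note [simp] = frechet_derivative_at[OF has_derivative_e11_frame, symmetric]
    frechet_derivative_at[OF has_derivative_e11_mult, symmetric]
  show "lie_bracket (e11_frame 2) (e11_frame 3) = e11_frame 1"
    "lie_bracket (e11_frame 1) (e11_frame 2) = (\<lambda>p. - e11_frame 3 p)"
    "lie_bracket (e11_frame 3) (e11_frame 1) = (\<lambda>p. 0)"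
    by (simp_all add: fun_eq_iff lie_bracket_def) (simp_all add: e11_frame_def)
  have inv: "e11_frame i \<in> lie_algebra e11_mult" for i
    using exhaust_3[of i]
    by (auto simp: lie_algebra_def left_invariant_field_def e11_frame_def e11_mult_def
        vec_eq_iff forall_3 cosh_add sinh_add algebra_simps)
  have "inj (\<lambda>i. e11_frame i p) \<and> independent (range (\<lambda>i. e11_frame i p))" for p
  proof
    have 1: "cosh (p$3) * cosh (p$3) = 1 + sinh (p$3) * sinh (p$3)"
      using hyperbolic_pythagoras[of "p$3"] by (simp add: power2_eq_square)
    have ne: "cosh (p$3) \<noteq> sinh (p$3)" "sinh (p$3) \<noteq> cosh (p$3)" using 1 by auto
    show inj: "inj (\<lambda>i. e11_frame i p)"
      by (simp add: inj_on_def forall_3 e11_frame_def vec_eq_iff ne)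
    have "a 1 = 0 \<and> a 2 = 0 \<and> a 3 = 0" if "(\<Sum>i\<in>UNIV. a i *\<^sub>R e11_frame i p) = 0" for a
    proof -
      have e: "a 2 = 0" "a 1 * sinh (p$3) + a 3 * cosh (p$3) = 0"
        "a 1 * cosh (p$3) + a 3 * sinh (p$3) = 0"
        using that by (simp_all add: sum_3 e11_frame_def vec_eq_iff forall_3)
      have "a 1 = 0" "a 3 = 0" using e(2,3) 1 by algebra+
      with e show ?thesis by simp
    qed
    then have zero: "a i = 0" if "(\<Sum>i\<in>UNIV. a i *\<^sub>R e11_frame i p) = 0" for a i
      using that exhaust_3[of i] by metis
    show "independent (range (\<lambda>i. e11_frame i p))"
    proof (rule independent_if_scalars_zero)
      fix f x
      assume "(\<Sum>x\<in>range (\<lambda>i. e11_frame i p). f x *\<^sub>R x) = 0"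
        and x: "x \<in> range (\<lambda>i. e11_frame i p)"
      then have "(\<Sum>i\<in>UNIV. f (e11_frame i p) *\<^sub>R e11_frame i p) = 0"
        by (simp add: sum.reindex[OF inj])
      from zero[OF this] x show "f x = 0" by auto
    qed simp
  qed
  then show "left_invariant_frame e11_mult e11_frame"
    using inv by (simp add: left_invariant_frame_def)
qed

end

(*
  In a g-orthonormal multiple of the frame the metric is a Milnor metric: its curvature operator is
  diagonal, with sectional curvatures
    K1 = -(A+1)(3A-1)/(4AB),  K2 = (A+1)^2/(4AB),  K3 = (A+1)(A-3)/(4AB),
  so H is diagonal in the same frame, with entries K2 K3, K3 K1, K1 K2. This also holds at A = 3 and
  A = 1/3, where P is singular, because K_m K_n is a quadratic polynomial in K_l whose coefficients
  do not depend on the frame. A diagonal endomorphism diag(d1, d2, d3) is a derivation iff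
  d1 = d2 + d3 and d3 = d1 + d2, that is iff d2 = 0 and d1 = d3. For the endomorphism of +-H minus
  kappa Id this says kappa = +-K3 K1 and K1 = K3 (as K2 > 0); moreover K1 = K3 iff A = 1, and then
  K1 = K3 = -1/B.
*)
theory Submission
  imports Defs
begin

section \<open>Derivatives of functions of the third coordinate, and matrix calculus\<close>

text \<open>Left invariant fields and metrics on E(1,1) depend on the rapidity coordinate only, so
  this chain rule reduces their derivatives to ordinary ones.\<close>

lemma frechet_derivative_height:
  fixes F :: "real \<Rightarrow> 'a::real_normed_vector" and p :: "real^3"
  assumes "(F has_vector_derivative F') (at (p$3))"
  shows "frechet_derivative (\<lambda>q. F (q$3)) (at p) = (\<lambda>h. h$3 *\<^sub>R F')"
proof -
  have "((\<lambda>q::real^3. q$3) has_derivative (\<lambda>h. h$3)) (at p)"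
    by (intro bounded_linear_imp_has_derivative bounded_linear_vec_nth)
  from diff_chain_at[OF this assms[unfolded has_vector_derivative_def]]
  show ?thesis
    by (intro frechet_derivative_at[symmetric]) (simp add: o_def)
qed

lemma partial_deriv_height:
  fixes f :: "real \<Rightarrow> real" and p :: "real^3"
  assumes "(f has_real_derivative d) (at (p$3))"
  shows "partial_deriv i (\<lambda>q. f (q$3)) p = (if i = 3 then d else 0)"
  using frechet_derivative_height[OF assms[unfolded has_real_derivative_iff_has_vector_derivative]]
  by (simp add: partial_deriv_def axis_def)

lemma bounded_bilinear_matrix_matrix_mult:
  "bounded_bilinear ((**) :: real^'n^'m \<Rightarrow> real^'k^'n \<Rightarrow> real^'k^'m)"
proof -
  have "bilinear ((**) :: real^'n^'m \<Rightarrow> real^'k^'n \<Rightarrow> real^'k^'m)"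
    unfolding bilinear_def
    by (intro conjI allI linearI)
      (simp_all add: matrix_matrix_mult_def vec_eq_iff algebra_simps sum.distrib sum_distrib_left)
  then show ?thesis by (simp add: bilinear_conv_bounded_bilinear)
qed

lemma has_vector_derivative_matrix:
  fixes F :: "real \<Rightarrow> real^'n^'m"
  shows "(F has_vector_derivative F') (at s) \<longleftrightarrow>
    (\<forall>i j. ((\<lambda>t. F t $ i $ j) has_real_derivative F' $ i $ j) (at s))"
proof -
  have "(F has_vector_derivative F') (at s) \<longleftrightarrow>
    (\<forall>b\<in>Basis. ((\<lambda>t. F t \<bullet> b) has_vector_derivative F' \<bullet> b) (at s))"
    by (auto simp: has_vector_derivative_def has_derivative_componentwise_within[of F])
  also have "\<dots> \<longleftrightarrow> (\<forall>i j. ((\<lambda>t. F t $ i $ j) has_real_derivative F' $ i $ j) (at s))"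
    by (auto simp: Basis_vec_def inner_axis has_real_derivative_iff_has_vector_derivative)
  finally show ?thesis .
qed

lemma matrix_add_rdistrib: "(A + B) ** C = A ** C + B ** (C :: real^'k^'n)"
  for A :: "real^'n^'m"
  by (rule bounded_bilinear.add_left[OF bounded_bilinear_matrix_matrix_mult])

lemma matrix_sub_ldistrib: "A ** (B - C) = A ** B - A ** (C :: real^'k^'n)"
  for A :: "real^'n^'m"
  by (rule bounded_bilinear.diff_right[OF bounded_bilinear_matrix_matrix_mult])

lemma matrix_sub_rdistrib: "(A - B) ** C = A ** C - B ** (C :: real^'k^'n)"
  for A :: "real^'n^'m"
  by (rule bounded_bilinear.diff_left[OF bounded_bilinear_matrix_matrix_mult])

lemma matrix_inv_unique:
  fixes A B :: "real^'n^'n"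
  assumes "A ** B = mat 1"
  shows "matrix_inv A = B"
proof -
  have BA: "B ** A = mat 1" using assms matrix_left_right_inverse by blast
  have "A ** matrix_inv A = mat 1 \<and> matrix_inv A ** A = mat 1"
    unfolding matrix_inv_def by (rule someI[of _ B]) (simp add: assms BA)
  then have "B ** (A ** matrix_inv A) = B" by simp
  then show ?thesis by (simp add: matrix_mul_assoc BA)
qed

lemma components_coframe:
  assumes "\<And>x y. g p x y = (W *v x) \<bullet> (W *v y)"
  shows "components g p = transpose W ** W"
  by (simp add: components_def assms vec_eq_iff matrix_vector_mult_def matrix_matrix_mult_def
      transpose_def inner_vec_def axis_def if_distrib cong: if_cong)

lemma inverse_metric_coframe:
  fixes W E :: "real^'n^'n"
  assumes g: "\<And>x y. g p x y = (W *v x) \<bullet> (W *v y)" and WE: "W ** E = mat 1"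
  shows "inverse_metric g p = E ** transpose E"
proof (rule matrix_inv_unique)
  have EW: "E ** W = mat 1" using WE matrix_left_right_inverse by blast
  have "transpose W ** W ** (E ** transpose E) = transpose W ** (W ** E) ** transpose E"
    by (simp add: matrix_mul_assoc)
  also have "\<dots> = transpose (E ** W)"
    by (simp add: WE matrix_transpose_mul)
  finally show "components g p ** (E ** transpose E) = mat 1"
    by (simp add: components_coframe[of g p W, OF g] EW)
qed

section \<open>Curvature of the left invariant metrics\<close>

text \<open>The rows of \<open>W s\<close> are the \<open>g\<close>-orthonormal coframe at the points of height \<open>s\<close>, and the columns
  of \<open>E s\<close> the dual frame. The brackets leave exactly this freedom in the choice of the frame; \<open>c\<close> is
  the sign of the third component of \<open>e 2\<close>. We take \<open>\<alpha> = sqrt A\<close> and \<open>\<beta> = sqrt B\<close>.\<close>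
locale e11_coframe =
  fixes \<alpha> \<beta> c u0 v0 k l :: real
  assumes pos: "\<alpha> > 0" "\<beta> > 0"
    and sign: "c * c = 1"
    and disc: "u0\<^sup>2 \<noteq> v0\<^sup>2"
begin

text \<open>The pair \<open>(u, v)\<close> is the covector \<open>(u0, v0)\<close> carried along by
  the boost of rapidity \<open>-s\<close>, as left invariance of the coframe demands.\<close>

definition u :: "real \<Rightarrow> real" where "u s = u0 * cosh s - v0 * sinh s"
definition v :: "real \<Rightarrow> real" where "v s = v0 * cosh s - u0 * sinh s"

definition W :: "real \<Rightarrow> real^3^3" where
  "W s = vector [vector [\<alpha> * u s, \<alpha> * v s, \<alpha> * k],
                 vector [0, 0, \<beta> * c],
                 vector [c * v s, c * u s, l]]"

definition \<delta> :: real where "\<delta> = u0\<^sup>2 - v0\<^sup>2"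

definition E :: "real \<Rightarrow> real^3^3" where
  "E s = vector
    [vector [u s / (\<alpha> * \<delta>), (l * v s - c * k * u s) / (\<beta> * \<delta>), - c * v s / \<delta>],
     vector [- v s / (\<alpha> * \<delta>), (c * k * v s - l * u s) / (\<beta> * \<delta>), c * u s / \<delta>],
     vector [0, c / \<beta>, 0]]"

text \<open>The matrix with \<open>W' = K W\<close>.\<close>
definition K :: "real^3^3" where
  "K = vector [vector [0, \<alpha> * l / \<beta>, - \<alpha> * c],
               vector [0, 0, 0],
               vector [- c / \<alpha>, k / \<beta>, 0]]"

text \<open>Milnor's constants of the orthonormal frame are \<open>-\<mu>, \<nu>, \<mu>\<close>, and \<open>M w\<close> is the matrix of
  \<open>\<nabla>\<close> in the direction with frame components \<open>w\<close>. With \<open>T i\<close> the Christoffel symbols are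
  \<open>\<Gamma>\<^sub>i = E T\<^sub>i W\<close>.\<close>
definition \<mu> :: "real" where "\<mu> = (1 + \<alpha>\<^sup>2) / (2 * \<alpha> * \<beta>)"
definition \<nu> :: "real" where "\<nu> = (\<alpha>\<^sup>2 - 1) / (2 * \<alpha> * \<beta>)"

definition M :: "real^3 \<Rightarrow> real^3^3" where
  "M w = vector [vector [0, - \<mu> * w$3, \<nu> * w$2],
                 vector [\<mu> * w$3, 0, \<mu> * w$1],
                 vector [- \<nu> * w$2, - \<mu> * w$1, 0]]"

definition T :: "3 \<Rightarrow> real \<Rightarrow> real^3^3" where
  "T i s = M (column i (W s)) + (if i = 3 then K else 0)"

text \<open>Boosts preserve the Lorentz norm. Up to the factor \<open>\<alpha> * c\<close>,
  \<open>\<delta>\<close> is the determinant of the horizontal block of \<open>W s\<close>, which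
  therefore stays invertible.\<close>

lemma delta_eq: "(u s)\<^sup>2 - (v s)\<^sup>2 = \<delta>"
proof -
  have "(u s)\<^sup>2 - (v s)\<^sup>2 = (u0\<^sup>2 - v0\<^sup>2) * ((cosh s)\<^sup>2 - (sinh s)\<^sup>2)"
    unfolding u_def v_def by algebra
  then show ?thesis by (simp add: hyperbolic_pythagoras \<delta>_def)
qed

lemma delta_nz: "\<delta> \<noteq> 0" using disc by (simp add: \<delta>_def)

lemma u2: "u s * u s = \<delta> + v s * v s"
  using delta_eq[of s] by (simp add: power2_eq_square)

lemma c_cases: "c = 1 \<or> c = -1"
  using sign by (metis square_eq_1_iff)

lemma sign_cancel: "c * (c * x) = x"
  using sign by (simp flip: mult.assoc)

lemma W_E: "W s ** E s = mat 1"
  using pos delta_nz c_cases u2[of s]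
  by (auto simp: matrix_matrix_mult_def vec_eq_iff forall_3 sum_3 mat_def W_def E_def divide_simps)
    (auto simp: algebra_simps)

lemma E_W: "E s ** W s = mat 1"
  using W_E matrix_left_right_inverse by blast

lemma deriv_uv:
  "(u has_real_derivative - v s) (at s)" "(v has_real_derivative - u s) (at s)"
  unfolding u_def[abs_def] v_def[abs_def] by (auto intro!: derivative_eq_intros)

lemma W_deriv: "(W has_vector_derivative K ** W s) (at s)"
  unfolding has_vector_derivative_matrix using pos c_cases
  by (auto simp: forall_3 matrix_matrix_mult_def sum_3 W_def K_def
      intro!: derivative_eq_intros deriv_uv)

lemma E_deriv: "(E has_vector_derivative - (E s ** K)) (at s)"
  unfolding has_vector_derivative_matrix using pos delta_nz c_cases
  by (auto simp: forall_3 matrix_matrix_mult_def sum_3 E_def K_def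
      intro!: derivative_eq_intros deriv_uv)
   (auto simp: divide_simps)

lemma T_deriv: "(T i has_vector_derivative M (column i (K ** W s))) (at s)"
  unfolding has_vector_derivative_matrix using pos c_cases exhaust_3[of i]
  by (auto simp: forall_3 matrix_matrix_mult_def sum_3 W_def K_def T_def M_def column_def
      intro!: derivative_eq_intros deriv_uv)

definition G' :: "real \<Rightarrow> real^3^3" where
  "G' s = transpose (W s) ** (K ** W s) + transpose (K ** W s) ** W s"

lemma G_deriv: "((\<lambda>s. transpose (W s) ** W s) has_vector_derivative G' s) (at s)"
proof -
  have "((\<lambda>s. transpose (W s)) has_vector_derivative transpose (K ** W s)) (at s)"
    using W_deriv by (simp add: has_vector_derivative_matrix transpose_def)
  from bounded_bilinear.has_vector_derivative[OF bounded_bilinear_matrix_matrix_mult this W_deriv]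
  show ?thesis by (simp add: G'_def)
qed

text \<open>The left side is twice a Christoffel symbol of the first kind, since only the third
  partial derivative survives. In \<open>T\<close>, \<open>M\<close> is the connection in the frame
  and \<open>K\<close> the gauge term from \<open>W' = K W\<close>.\<close>

lemma first_kind:
  "(if i = 3 then G' s $ j $ m else 0) + (if j = 3 then G' s $ i $ m else 0)
     - (if m = 3 then G' s $ i $ j else 0)
   = 2 * (transpose (W s) ** T i s ** W s) $ m $ j"
proof -
  note defs = G'_def T_def M_def W_def K_def transpose_def matrix_matrix_mult_def sum_3 column_def
    \<mu>_def \<nu>_def
  show ?thesis
    using exhaust_3[of i] exhaust_3[of j] exhaust_3[of m] pos
    by (elim disjE) (simp_all add: defs, simp_all add: field_simps power2_eq_square sign_cancel sign)
qed

text \<open>Since \<open>E' = - E K\<close> and \<open>W' = K W\<close>, differentiating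
  \<open>E T W\<close> adds a commutator with \<open>K\<close> to the entrywise derivative of
  \<open>T\<close>.\<close>

definition T' :: "3 \<Rightarrow> real \<Rightarrow> real^3^3" where
  "T' i s = M (column i (K ** W s)) + T i s ** K - K ** T i s"

lemma ETW_deriv:
  "((\<lambda>s. E s ** T i s ** W s) has_vector_derivative E s ** T' i s ** W s) (at s)"
proof -
  note [derivative_intros] =
    bounded_bilinear.has_vector_derivative[OF bounded_bilinear_matrix_matrix_mult]
  show ?thesis
    by (rule has_vector_derivative_eq_rhs, (rule derivative_intros E_deriv T_deriv W_deriv)+)
      (simp add: T'_def matrix_add_ldistrib matrix_add_rdistrib matrix_mul_assoc matrix_sub_ldistrib
        matrix_sub_rdistrib bounded_bilinear.minus_left[OF bounded_bilinear_matrix_matrix_mult])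
qed

definition R :: "3 \<Rightarrow> 3 \<Rightarrow> real \<Rightarrow> real^3^3" where
  "R i j s = (if i = 3 then T' j s else 0) - (if j = 3 then T' i s else 0)
     + (T i s ** T j s - T j s ** T i s)"

text \<open>The sectional curvatures for \<open>A = \<alpha>\<^sup>2\<close> and
  \<open>B = \<beta>\<^sup>2\<close>; entry \<open>l\<close> belongs to the plane orthogonal to
  frame vector \<open>l\<close>.\<close>

definition sect :: "real^3" where
  "sect = vector [- ((\<alpha>\<^sup>2 + 1) * (3 * \<alpha>\<^sup>2 - 1)) / (4 * \<alpha>\<^sup>2 * \<beta>\<^sup>2),
                (\<alpha>\<^sup>2 + 1)\<^sup>2 / (4 * \<alpha>\<^sup>2 * \<beta>\<^sup>2),
                (\<alpha>\<^sup>2 + 1) * (\<alpha>\<^sup>2 - 3) / (4 * \<alpha>\<^sup>2 * \<beta>\<^sup>2)]"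

text \<open>The cross product identifies bivectors with vectors, so this says that the curvature
  operator is diagonal with eigenvalues \<open>sect\<close>. With \<open>z\<close> as first factor
  the sign agrees with \<open>sectional_curvature\<close>.\<close>

lemma R_cross:
  "R i j s *v z = cross3 z (sect * cross3 (column i (W s)) (column j (W s)))"
proof -
  note defs = R_def T'_def T_def M_def W_def K_def matrix_matrix_mult_def matrix_vector_mult_def
    sum_3 column_def \<mu>_def \<nu>_def sect_def cross3_def vec_eq_iff forall_3
  show ?thesis
    using exhaust_3[of i] exhaust_3[of j] pos
    by (elim disjE) (simp_all add: defs, simp_all add: field_simps power2_eq_square sign_cancel sign)
qed

end

section \<open>Connection and curvature in coordinates\<close>

locale e11_metric = e11_coframe +
  fixes g :: "3 tensor2"
  assumes g: "g p x y = (W (p$3) *v x) \<bullet> (W (p$3) *v y)"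
begin

lemmas components_metric = components_coframe[OF g]
  and inverse_metric = inverse_metric_coframe[OF g W_E]

lemma christoffel_matrix:
  "christoffel g n i j p = (E (p$3) ** T i (p$3) ** W (p$3)) $ n $ j"
proof -
  let ?W = "W (p$3)" and ?E = "E (p$3)" and ?T = "T i (p$3)"
  have pd: "partial_deriv i (\<lambda>q. components g q $ j $ m) p = (if i = 3 then G' (p$3) $ j $ m else 0)"
    for i j m
    unfolding components_metric using G_deriv
    by (intro partial_deriv_height) (simp add: has_vector_derivative_matrix)
  have "christoffel g n i j p = (\<Sum>m\<in>UNIV. (?E ** transpose ?E) $ n $ m
      * (transpose ?W ** ?T ** ?W) $ m $ j)"
    unfolding christoffel_def pd first_kind inverse_metric
    by (simp add: sum_distrib_left)
  also have "\<dots> = ((?E ** transpose ?E) ** (transpose ?W ** ?T ** ?W)) $ n $ j"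
    by (simp add: matrix_matrix_mult_def)
  also have "(?E ** transpose ?E) ** (transpose ?W ** ?T ** ?W)
      = ?E ** transpose (?W ** ?E) ** ?T ** ?W"
    by (simp add: matrix_mul_assoc matrix_transpose_mul)
  finally show ?thesis by (simp add: W_E)
qed

lemma curvature_comp_matrix:
  "curvature_comp g n i j m p = (E (p$3) ** R i j (p$3) ** W (p$3)) $ n $ m"
proof -
  let ?W = "W (p$3)" and ?E = "E (p$3)"
  have pd: "partial_deriv i (christoffel g n j m) p
      = (if i = 3 then (?E ** T' j (p$3) ** ?W) $ n $ m else 0)" for i j n m
    unfolding christoffel_matrix[abs_def] using ETW_deriv
    by (intro partial_deriv_height) (simp add: has_vector_derivative_matrix)
  \<comment> \<open>Products of Christoffel matrices can be formed in the frame because the inner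
    factors \<open>W\<close> and \<open>E\<close> cancel.\<close>
  have mult: "(?E ** X ** ?W) ** (?E ** Y ** ?W) = ?E ** (X ** Y) ** ?W" for X Y
  proof -
    have "(?E ** X ** ?W) ** (?E ** Y ** ?W) = ?E ** X ** (?W ** ?E) ** Y ** ?W"
      by (simp add: matrix_mul_assoc)
    then show ?thesis by (simp add: W_E matrix_mul_assoc)
  qed
  have "(\<Sum>q\<in>UNIV. christoffel g n i q p * christoffel g q j m p
      - christoffel g n j q p * christoffel g q i m p)
    = ((?E ** T i (p$3) ** ?W) ** (?E ** T j (p$3) ** ?W)
       - (?E ** T j (p$3) ** ?W) ** (?E ** T i (p$3) ** ?W)) $ n $ m"
    by (simp add: christoffel_matrix matrix_matrix_mult_def[of "?E ** _ ** ?W" "?E ** _ ** ?W"] sum_subtractf)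
  then show ?thesis
    unfolding curvature_comp_def pd mult
    by (simp add: R_def matrix_add_ldistrib matrix_add_rdistrib matrix_sub_ldistrib
        matrix_sub_rdistrib)
qed

text \<open>Linearity extends \<open>R_cross\<close> from coordinate directions: the columns of
  \<open>W\<close> recombine to \<open>W x\<close> and \<open>W y\<close>.\<close>

lemma curvature_cross:
  "W (p$3) *v curvature g p x y z
    = cross3 (W (p$3) *v z) (sect * cross3 (W (p$3) *v x) (W (p$3) *v y))"
proof -
  let ?W = "W (p$3)" and ?E = "E (p$3)"
  have "curvature g p x y z
      = (\<Sum>i\<in>UNIV. \<Sum>j\<in>UNIV. (x$i * y$j) *\<^sub>R ((?E ** R i j (p$3) ** ?W) *v z))"
    by (simp add: vec_eq_iff curvature_def curvature_comp_matrix matrix_vector_mult_def[of "?E ** _ ** ?W"]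
        sum_distrib_left mult_ac)
  then have "?W *v curvature g p x y z
      = (\<Sum>i\<in>UNIV. \<Sum>j\<in>UNIV. (x$i * y$j) *\<^sub>R ((?W ** ?E) *v (R i j (p$3) *v (?W *v z))))"
    by (simp add: linear_sum linear_scale[OF matrix_vector_mul_linear] matrix_vector_mul_assoc matrix_mul_assoc)
  also have "\<dots> = (\<Sum>i\<in>UNIV. \<Sum>j\<in>UNIV. (x$i * y$j) *\<^sub>R
      cross3 (?W *v z) (sect * cross3 (column i ?W) (column j ?W)))"
    by (simp add: W_E R_cross)
  also have "\<dots> = cross3 (?W *v z) (sect * cross3 (?W *v x) (?W *v y))"
    by (simp add: matrix_vector_mult_def column_def cross3_def vec_eq_iff forall_3 sum_3 algebra_simps)
  finally show ?thesis .
qed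

end

section \<open>Cross curvature when the curvature operator is diagonal\<close>

text \<open>These numerals arise from \<open>l + 1\<close> and \<open>l + 2\<close> when a cyclic
  index wraps around.\<close>

lemma index3_wrap [simp]: "(4::3) = 1" "(5::3) = 2"
  by simp_all

text \<open>The cross product is the remaining row times \<open>det Q\<close>, which is 1 or -1;
  squaring admits frames of either orientation.\<close>

lemma cross3_rows_orthogonal_matrix:
  fixes Q :: "real^3^3"
  assumes "orthogonal_matrix Q"
  shows "(cross3 (Q$(l+1)) (Q$(l+2)) $ a)\<^sup>2 = (Q$l$a)\<^sup>2"
proof -
  have row: "Q$i = transpose Q *v axis i 1" for i
    by (simp add: matrix_vector_mult_basis column_def transpose_def vec_eq_iff)
  have oT: "orthogonal_matrix (transpose Q)" using assms by simp
  have "cross3 (Q$(l+1)) (Q$(l+2)) = det Q *\<^sub>R Q$l"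
    unfolding row cross_orthogonal_matrix[OF oT] using exhaust_3[of l]
    by (auto simp: cross_basis)
  moreover have "(det Q)\<^sup>2 = 1"
    using det_orthogonal_matrix[OF assms] by auto
  ultimately show ?thesis by (simp add: power_mult_distrib)
qed

text \<open>The product of the other two numbers is a polynomial in \<open>\<kappa> l\<close> whose coefficients are
  symmetric functions, so it is unaffected by a change of the diagonalizing frame.\<close>
lemma prod_cyclic3:
  fixes \<kappa> :: "3 \<Rightarrow> real"
  shows "\<kappa> (l+1) * \<kappa> (l+2)
    = (\<kappa> l)\<^sup>2 - sum \<kappa> UNIV * \<kappa> l + ((sum \<kappa> UNIV)\<^sup>2 - (\<Sum>a\<in>UNIV. (\<kappa> a)\<^sup>2)) / 2"
  using exhaust_3[of l] by (auto simp: sum_3 power2_eq_square algebra_simps)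

text \<open>By \<open>eig\<close>, \<open>\<tau> l = \<kappa> a\<close> wherever
  \<open>Q$l$a\<close> is nonzero. Equal power sums and \<open>prod_cyclic3\<close> transfer this to
  the products of the other two values, even when eigenvalues repeat.\<close>

lemma cofactors_diagonalization:
  fixes Q :: "real^3^3" and \<tau> \<kappa> :: "3 \<Rightarrow> real"
  assumes Q: "orthogonal_matrix Q"
    and eig: "\<And>l a. \<tau> l * Q$l$a = \<kappa> a * Q$l$a"
  shows "(\<Sum>l\<in>UNIV. \<tau> (l+1) * \<tau> (l+2) * (Q$l$a * Q$l$b))
    = (if a = b then \<kappa> (a+1) * \<kappa> (a+2) else 0)"
proof -
  have rows: "(\<Sum>a\<in>UNIV. (Q$l$a)\<^sup>2) = 1" for l
    using Q by (simp add: orthogonal_matrix_def vec_eq_iff matrix_matrix_mult_def transpose_def mat_def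
        power2_eq_square)
  have cols: "(\<Sum>l\<in>UNIV. Q$l$a * Q$l$b) = (if a = b then 1 else 0)" for a b
    using Q by (simp add: orthogonal_matrix vec_eq_iff matrix_matrix_mult_def transpose_def mat_def)
  have power_sum: "(\<Sum>l\<in>UNIV. \<tau> l ^ n) = (\<Sum>a\<in>UNIV. \<kappa> a ^ n)" for n
  proof -
    have eign: "\<tau> l ^ n * Q$l$a = \<kappa> a ^ n * Q$l$a" for l a
      using eig[of l a] by (cases "Q$l$a = 0") auto
    have "(\<Sum>l\<in>UNIV. \<tau> l ^ n) = (\<Sum>l\<in>UNIV. \<Sum>a\<in>UNIV. \<tau> l ^ n * (Q$l$a)\<^sup>2)"
      by (simp add: rows flip: sum_distrib_left)
    also have "\<dots> = (\<Sum>a\<in>UNIV. \<Sum>l\<in>UNIV. \<kappa> a ^ n * (Q$l$a * Q$l$a))"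
      by (subst sum.swap) (simp add: power2_eq_square eign flip: mult.assoc)
    also have "\<dots> = (\<Sum>a\<in>UNIV. \<kappa> a ^ n)"
      by (simp add: cols flip: sum_distrib_left)
    finally show ?thesis .
  qed
  have "\<tau> (l+1) * \<tau> (l+2) * Q$l$a = \<kappa> (a+1) * \<kappa> (a+2) * Q$l$a" for l
    unfolding prod_cyclic3[of \<tau>] prod_cyclic3[of \<kappa>] using power_sum[of 1] power_sum[of 2] eig[of l a]
    by (cases "Q$l$a = 0") auto
  then have "(\<Sum>l\<in>UNIV. \<tau> (l+1) * \<tau> (l+2) * (Q$l$a * Q$l$b))
      = (\<Sum>l\<in>UNIV. \<kappa> (a+1) * \<kappa> (a+2) * (Q$l$a * Q$l$b))"
    unfolding mult.assoc[symmetric] by (simp only:)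
  then show ?thesis by (simp add: cols flip: sum_distrib_left)
qed

definition diag :: "real^'n \<Rightarrow> real^'n^'n" where
  "diag d = (\<chi> i j. if i = j then d $ i else 0)"

lemma matrix_mul_diag: "(A ** diag d) $ i $ j = A $ i $ j * d $ j"
  by (simp add: diag_def matrix_matrix_mult_def if_distrib cong: if_cong)

lemma diag_mul_diag: "diag a ** diag b = diag (a * b)"
  by (simp add: vec_eq_iff matrix_mul_diag) (simp add: diag_def)

lemma diag_mul_vector: "(diag d *v x) $ i = d $ i * x $ i"
  by (simp add: diag_def matrix_vector_mult_def if_distrib[of "\<lambda>x. x * _"] cong: if_cong)

lemma diag_1: "diag 1 = mat 1"
  by (simp add: diag_def mat_def vec_eq_iff)

lemma det_diag3: "det (diag d :: real^3^3) = d$1 * d$2 * d$3"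
  by (simp add: det_3 diag_def)

text \<open>The rows of \<open>W\<close> form an orthonormal coframe at \<open>p\<close> that diagonalizes the curvature operator:
  up to sign \<open>R(x, y)\<close> is the infinitesimal rotation about the vector \<open>\<kappa> * (x \<times> y)\<close>.\<close>
locale diagonal_curvature =
  fixes g :: "3 tensor2" and p :: "real^3" and W E :: "real^3^3" and \<kappa> :: "real^3"
  assumes metric: "g p x y = (W *v x) \<bullet> (W *v y)"
    and curv: "W *v curvature g p x y z = cross3 (W *v z) (\<kappa> * cross3 (W *v x) (W *v y))"
    and W_E: "W ** E = mat 1"
begin

lemma E_W: "E ** W = mat 1"
  using W_E matrix_left_right_inverse by blast

lemma W_E_vector [simp]: "W *v (E *v x) = x" "E *v (W *v x) = x"
  by (simp_all add: matrix_vector_mul_assoc W_E E_W)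

lemma WT_ET: "transpose W ** transpose E = mat 1" "transpose E ** transpose W = mat 1"
  by (simp_all add: E_W W_E flip: matrix_transpose_mul)

lemmas inverse_metric = inverse_metric_coframe[of g p W E, OF metric W_E]

abbreviation \<sigma> :: real where "\<sigma> \<equiv> \<kappa>$1 + \<kappa>$2 + \<kappa>$3"

text \<open>Conjugation by \<open>W\<close> moves the trace defining Ricci to the frame, where the
  eigenvalue in direction \<open>l\<close> is the sum of the curvatures of the two planes containing
  it.\<close>

lemma ricci_diag: "ricci g p y z = (W *v y) \<bullet> (diag (vec \<sigma> - \<kappa>) *v (W *v z))"
proof -
  define F where "F \<xi> = cross3 (W *v z) (\<kappa> * cross3 \<xi> (W *v y))" for \<xi>
  have F: "matrix F *v \<xi> = F \<xi>" for \<xi>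
    by (simp add: F_def matrix_def matrix_vector_mult_def cross3_def axis_def vec_eq_iff forall_3
        sum_3 algebra_simps)
  have "curvature g p x y z = (E ** matrix F ** W) *v x" for x
  proof -
    have "curvature g p x y z = E *v (W *v curvature g p x y z)" by simp
    also have "\<dots> = E *v (matrix F *v (W *v x))"
      by (simp only: curv F F_def)
    finally show ?thesis by (simp add: matrix_vector_mul_assoc matrix_mul_assoc)
  qed
  then have "ricci g p y z = trace (E ** matrix F ** W)"
    by (simp add: ricci_def trace_def matrix_vector_mult_basis column_def)
  also have "\<dots> = trace (W ** (E ** matrix F))" by (rule trace_mul_sym)
  also have "\<dots> = trace (matrix F)" by (simp add: matrix_mul_assoc W_E)
  also have "\<dots> = (W *v y) \<bullet> (diag (vec \<sigma> - \<kappa>) *v (W *v z))"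
    by (simp add: trace_def matrix_def F_def sum_3 inner_vec_def cross3_def axis_def
        diag_mul_vector algebra_simps)
  finally show ?thesis .
qed

lemma components_ricci: "components (ricci g) p = transpose W ** diag (vec \<sigma> - \<kappa>) ** W"
proof -
  have "ricci g p y z = y \<bullet> ((transpose W ** diag (vec \<sigma> - \<kappa>) ** W) *v z)" for y z
    by (simp add: ricci_diag dot_lmul_matrix[symmetric] flip: matrix_vector_mul_assoc)
      (metis dot_lmul_matrix transpose_matrix_vector transpose_transpose)
  then show ?thesis
    by (simp add: components_def vec_eq_iff matrix_vector_mult_basis column_def inner_axis')
qed

lemma scalar_curvature_eq: "scalar_curvature g p = 2 * \<sigma>"
proof -
  let ?D = "diag (vec \<sigma> - \<kappa>)"
  have sym: "transpose ?D = ?D"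
    by (simp add: diag_def transpose_def vec_eq_iff)
  have "scalar_curvature g p
      = trace (inverse_metric g p ** transpose (components (ricci g) p))"
    by (simp add: scalar_curvature_def trace_def matrix_matrix_mult_def transpose_def)
  also have "\<dots> = trace (E ** (transpose E ** transpose W) ** ?D ** W)"
    by (simp add: inverse_metric components_ricci matrix_transpose_mul matrix_mul_assoc sym)
  also have "\<dots> = trace (W ** (E ** ?D))"
    by (simp add: WT_ET trace_mul_sym[of W])
  also have "\<dots> = 2 * \<sigma>"
    by (simp add: matrix_mul_assoc W_E) (simp add: trace_def diag_def sum_3)
  finally show ?thesis .
qed

text \<open>The scalar curvature is \<open>2 * \<sigma>\<close>, so the frame entries of
  \<open>P\<close> are \<open>(\<sigma> - \<kappa>$l) - \<sigma>\<close>.\<close>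

lemma cross_P_diag: "cross_P g p = E ** diag (- \<kappa>) ** transpose E"
proof -
  let ?D = "diag (vec \<sigma> - \<kappa>)"
  have "(\<Sum>k\<in>UNIV. \<Sum>l\<in>UNIV. inverse_metric g p $ i $ k * inverse_metric g p $ j $ l
          * components (ricci g) p $ k $ l)
      = (inverse_metric g p ** components (ricci g) p ** transpose (inverse_metric g p)) $ i $ j"
    for i j
    by (subst sum.swap) (simp add: matrix_matrix_mult_def transpose_def sum_distrib_left sum_distrib_right mult_ac)
  moreover have "inverse_metric g p ** components (ricci g) p ** transpose (inverse_metric g p)
      = E ** (transpose E ** transpose W) ** ?D ** (W ** E) ** transpose E"
    by (simp add: inverse_metric components_ricci matrix_transpose_mul matrix_mul_assoc)
  ultimately have "cross_P g p = E ** ?D ** transpose E - \<sigma> *\<^sub>R (E ** transpose E)"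
    by (simp add: cross_P_def vec_eq_iff WT_ET W_E scalar_curvature_eq inverse_metric)
  also have "\<dots> = E ** diag (- \<kappa>) ** transpose E"
    by (simp add: vec_eq_iff matrix_matrix_mult_def[of _ "transpose E"] matrix_mul_diag sum_3
        algebra_simps)
  finally show ?thesis .
qed

definition cross_form :: "real^3 \<Rightarrow> real^3 \<Rightarrow> real" where
  "cross_form x y = (\<Sum>l\<in>UNIV. \<kappa>$(l+1) * \<kappa>$(l+2) * (W *v x)$l * (W *v y)$l)"

text \<open>The determinant quotient is \<open>- (\<kappa>$1 * \<kappa>$2 * \<kappa>$3)\<close> and
  the inverse of \<open>P\<close> has frame entries \<open>- 1 / \<kappa>$l\<close>, so each product
  leaves the other two curvatures.\<close>

lemma cross_curvature_invertible:
  assumes "invertible (cross_P g p)"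
  shows "cross_curvature g p x y = cross_form x y"
proof -
  have detP: "det (cross_P g p) = - ((det E)\<^sup>2 * (\<kappa>$1 * \<kappa>$2 * \<kappa>$3))"
    by (simp add: cross_P_diag det_mul det_diag3 power2_eq_square)
  with assms have nz: "det E \<noteq> 0" "\<kappa>$1 \<noteq> 0" "\<kappa>$2 \<noteq> 0" "\<kappa>$3 \<noteq> 0"
    by (auto simp: invertible_det_nz)
  define D where "D = diag (\<chi> i. - (1 / \<kappa>$i))"
  have D: "diag (- \<kappa>) ** D = mat 1"
  proof -
    have "- \<kappa> * (\<chi> i. - (1 / \<kappa>$i)) = 1" using nz by (simp add: vec_eq_iff forall_3)
    then show ?thesis by (simp add: D_def diag_mul_diag diag_1)
  qed
  have inv: "matrix_inv (cross_P g p) = transpose W ** D ** W"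
  proof (rule matrix_inv_unique)
    have "cross_P g p ** (transpose W ** D ** W)
        = E ** diag (- \<kappa>) ** (transpose E ** transpose W) ** D ** W"
      by (simp add: cross_P_diag matrix_mul_assoc)
    also have "\<dots> = E ** (diag (- \<kappa>) ** D) ** W"
      by (simp add: WT_ET matrix_mul_assoc)
    finally show "cross_P g p ** (transpose W ** D ** W) = mat 1" by (simp add: D E_W)
  qed
  have "cross_curvature g p x y
      = - (\<kappa>$1 * \<kappa>$2 * \<kappa>$3) * (x \<bullet> (matrix_inv (cross_P g p) *v y))"
    using assms nz
    by (simp add: cross_curvature_def detP inverse_metric det_mul inner_vec_def matrix_vector_mult_def
        sum_distrib_left power2_eq_square mult_ac)
  also have "x \<bullet> (matrix_inv (cross_P g p) *v y) = (W *v x) \<bullet> (D *v (W *v y))"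
    unfolding inv
    by (metis dot_lmul_matrix matrix_vector_mul_assoc transpose_matrix_vector transpose_transpose)
  finally have eq: "cross_curvature g p x y
      = - (\<kappa>$1 * \<kappa>$2 * \<kappa>$3) * ((W *v x) \<bullet> (D *v (W *v y)))" .
  show ?thesis
    unfolding eq D_def cross_form_def using nz
    by (simp add: inner_vec_def diag_mul_vector sum_3) (simp add: field_simps)
qed

text \<open>Ensures that the \<open>SOME\<close> in \<open>cross_curvature\<close> really picks a
  Ricci frame.\<close>

lemma ricci_frame_exists: "ricci_frame g p (\<lambda>l. E *v axis l 1)"
  by (auto simp: ricci_frame_def metric ricci_diag inner_axis' diag_mul_vector) (auto simp: axis_def)

text \<open>In frame coordinates Ricci is \<open>\<sigma>\<close> times the identity minus
  \<open>diag \<kappa>\<close>, so an orthonormal frame diagonalizing Ricci also diagonalizes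
  \<open>\<kappa>\<close>.\<close>

lemma ricci_frame_matrix:
  assumes "ricci_frame g p f"
  shows "orthogonal_matrix (\<chi> l. W *v f l)" "l \<noteq> m \<Longrightarrow> (W *v f l) \<bullet> (\<kappa> * (W *v f m)) = 0"
proof -
  have on: "(W *v f i) \<bullet> (W *v f j) = (if i = j then 1 else 0)" for i j
    using assms by (simp add: ricci_frame_def metric)
  then have "(\<chi> l. W *v f l) ** transpose (\<chi> l. W *v f l) = mat 1"
    by (simp add: vec_eq_iff matrix_matrix_mult_def transpose_def mat_def inner_vec_def)
  then show "orthogonal_matrix (\<chi> l. W *v f l)"
    by (simp add: orthogonal_matrix matrix_left_right_inverse)
  assume "l \<noteq> m"
  then have "(W *v f l) \<bullet> (diag (vec \<sigma> - \<kappa>) *v (W *v f m)) = 0" "(W *v f l) \<bullet> (W *v f m) = 0"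
    using assms on by (simp_all add: ricci_frame_def ricci_diag)
  moreover have "diag (vec \<sigma> - \<kappa>) *v (W *v f m) = \<sigma> *\<^sub>R (W *v f m) - \<kappa> * (W *v f m)"
    by (simp add: vec_eq_iff diag_mul_vector algebra_simps)
  ultimately show "(W *v f l) \<bullet> (\<kappa> * (W *v f m)) = 0"
    by (simp add: inner_diff_right)
qed

text \<open>In frame coordinates \<open>f (l + 1)\<close> and \<open>f (l + 2)\<close> have cross
  product \<open>f l\<close> up to sign, so the curvature operator is evaluated on the normal of the
  plane.\<close>

lemma frame_sectional_eq:
  assumes "ricci_frame g p f"
  shows "frame_sectional g p f l = (W *v f l) \<bullet> (\<kappa> * (W *v f l))"
proof -
  let ?Q = "\<chi> l. W *v f l"
  have on: "g p (f i) (f j) = (if i = j then 1 else 0)" for i j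
    using assms by (simp add: ricci_frame_def)
  have ne: "l + 1 \<noteq> l + 2" using exhaust_3[of l] by auto
  have "frame_sectional g p f l
      = cross3 (W *v f (l+2)) (\<kappa> * cross3 (W *v f (l+1)) (W *v f (l+2))) \<bullet> (W *v f (l+1))"
    unfolding frame_sectional_def sectional_curvature_def on
    using ne by (simp add: metric curv)
  also have "\<dots> = (\<Sum>a\<in>UNIV. \<kappa>$a * (cross3 (W *v f (l+1)) (W *v f (l+2)) $ a)\<^sup>2)"
    by (simp add: sum_3 inner_vec_def cross3_def power2_eq_square algebra_simps)
  also have "\<dots> = (\<Sum>a\<in>UNIV. \<kappa>$a * ((W *v f l)$a)\<^sup>2)"
    using cross3_rows_orthogonal_matrix[OF ricci_frame_matrix(1)[OF assms], of l] by simp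
  finally show ?thesis by (simp add: inner_vec_def power2_eq_square mult_ac)
qed

lemma ricci_frame_eigen:
  assumes "ricci_frame g p f"
  shows "frame_sectional g p f l * (W *v f l)$a = \<kappa>$a * (W *v f l)$a"
proof -
  let ?Q = "\<chi> l. W *v f l" and ?\<tau> = "\<chi> l. frame_sectional g p f l"
  have Q: "transpose ?Q ** ?Q = mat 1"
    using ricci_frame_matrix(1)[OF assms] by (simp add: orthogonal_matrix)
  have "(?Q ** diag \<kappa> ** transpose ?Q) $ i $ j = diag ?\<tau> $ i $ j" for i j
    using ricci_frame_matrix(2)[OF assms, of i j] frame_sectional_eq[OF assms, of i]
    by (cases "i = j")
      (simp_all add: matrix_matrix_mult_def[of "_ ** diag _"] matrix_mul_diag transpose_def inner_vec_def
        diag_def[of ?\<tau>] mult_ac)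
  then have "?Q ** diag \<kappa> ** transpose ?Q = diag ?\<tau>" by (simp add: vec_eq_iff)
  then have "?Q ** diag \<kappa> ** (transpose ?Q ** ?Q) = diag ?\<tau> ** ?Q"
    by (simp add: matrix_mul_assoc)
  then have "(?Q ** diag \<kappa>) $ l $ a = (diag ?\<tau> ** ?Q) $ l $ a"
    by (simp add: Q)
  then show ?thesis
    by (auto simp: matrix_mul_diag)
      (auto simp: matrix_matrix_mult_def diag_def if_distrib[of "\<lambda>x. x * _"] cong: if_cong)
qed

text \<open>Holds for every Ricci frame, which makes the arbitrary choice in the singular case
  harmless.\<close>

lemma cross_curvature_frame:
  assumes "ricci_frame g p f"
  shows "(\<Sum>l\<in>UNIV. frame_sectional g p f (l + 1) * frame_sectional g p f (l + 2)
           * g p x (f l) * g p y (f l)) = cross_form x y"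
proof -
  let ?Q = "\<chi> l. W *v f l" and ?\<tau> = "frame_sectional g p f"
  have cofactors: "(\<Sum>l\<in>UNIV. ?\<tau> (l+1) * ?\<tau> (l+2) * (?Q$l$a * ?Q$l$b))
      = (if a = b then \<kappa>$(a+1) * \<kappa>$(a+2) else 0)" for a b
    by (rule cofactors_diagonalization[OF ricci_frame_matrix(1)[OF assms]])
      (simp add: ricci_frame_eigen[OF assms])
  have "(\<Sum>l\<in>UNIV. ?\<tau> (l+1) * ?\<tau> (l+2) * g p x (f l) * g p y (f l))
      = (\<Sum>l\<in>UNIV. \<Sum>a\<in>UNIV. \<Sum>b\<in>UNIV. (W *v x)$a * (W *v y)$b *
          (?\<tau> (l+1) * ?\<tau> (l+2) * (?Q$l$a * ?Q$l$b)))"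
    by (simp add: metric inner_vec_def sum_distrib_left sum_distrib_right mult_ac)
  also have "\<dots> = (\<Sum>a\<in>UNIV. \<Sum>b\<in>UNIV. (W *v x)$a * (W *v y)$b *
          (\<Sum>l\<in>UNIV. ?\<tau> (l+1) * ?\<tau> (l+2) * (?Q$l$a * ?Q$l$b)))"
    unfolding sum_distrib_left
    by (rule trans[OF sum.swap], rule sum.cong[OF refl], rule sum.swap)
  also have "\<dots> = cross_form x y"
    unfolding cofactors by (simp add: cross_form_def mult_ac if_distrib[of "\<lambda>x. _ * x"] cong: if_cong)
  finally show ?thesis .
qed

lemma cross_curvature_diagonal: "cross_curvature g p x y = cross_form x y"
proof (cases "invertible (cross_P g p)")
  case False
  have "ricci_frame g p (SOME f. ricci_frame g p f)"
    by (rule someI[where P = "ricci_frame g p", OF ricci_frame_exists])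
  with False show ?thesis
    by (simp add: cross_curvature_def Let_def cross_curvature_frame)
qed (rule cross_curvature_invertible)

end

section \<open>Left invariant fields and derivations on E(1,1)\<close>

text \<open>The linear part of left translation by a point of height \<open>s\<close>; left
  translations being affine, it is also their derivative everywhere.\<close>

definition boost :: "real \<Rightarrow> real^3 \<Rightarrow> real^3" where
  "boost s x = vector [cosh s * x$1 + sinh s * x$2, sinh s * x$1 + cosh s * x$2, x$3]"

lemma frechet_derivative_e11_mult: "frechet_derivative (e11_mult p) (at q) = boost (p$3)"
  unfolding frechet_derivative_at[OF has_derivative_e11_mult, symmetric]
  by (simp add: fun_eq_iff e11_mult_def boost_def vec_eq_iff forall_3)

lemma boost_boost: "boost s (boost t x) = boost (s + t) x"
  by (simp add: boost_def vec_eq_iff forall_3 cosh_add sinh_add algebra_simps)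

lemma e11_mult_height [simp]: "e11_mult p q $ 3 = p$3 + q$3"
  by (simp add: e11_mult_def)

lemma lie_algebra_e11: "X \<in> lie_algebra e11_mult \<longleftrightarrow> (\<forall>p. X p = boost (p$3) (X 0))"
proof -
  have "X (e11_mult p q) = boost (p$3) (X q)" if "\<forall>p. X p = boost (p$3) (X 0)" for p q
    unfolding that[rule_format, of q] boost_boost
    by (rule trans[OF that[rule_format, of "e11_mult p q"]]) simp
  moreover have "X p = boost (p$3) (X 0)" if "\<forall>p q. X (e11_mult p q) = boost (p$3) (X q)" for p
    by (rule trans[OF _ that[rule_format, of p 0]]) simp
  ultimately show ?thesis
    unfolding lie_algebra_def left_invariant_field_def frechet_derivative_e11_mult by blast
qed

lemma boost_deriv:
  "((\<lambda>s. boost s x) has_vector_derivative vector [boost s x $ 2, boost s x $ 1, 0]) (at s)"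
  unfolding boost_def vec3_eq
  by (auto intro!: derivative_eq_intros simp: has_vector_derivative_def fun_eq_iff vec_eq_iff
      forall_3 axis_def algebra_simps)

text \<open>The value at the identity suffices to read off structure equations; there the derivative
  of \<open>boost\<close> swaps the first two components.\<close>

lemma lie_bracket_e11:
  assumes "X \<in> lie_algebra e11_mult" "Y \<in> lie_algebra e11_mult"
  shows "lie_bracket X Y 0 = vector [X 0$3 * Y 0$2 - Y 0$3 * X 0$2, X 0$3 * Y 0$1 - Y 0$3 * X 0$1, 0]"
proof -
  have "frechet_derivative X (at 0) = (\<lambda>h. h$3 *\<^sub>R vector [X 0$2, X 0$1, 0])"
    if "X \<in> lie_algebra e11_mult" for X
  proof -
    have "(\<lambda>q. boost (q$3) (X 0)) = X" using that unfolding lie_algebra_e11 fun_eq_iff by metis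
    with frechet_derivative_height[OF boost_deriv, of "X 0" 0] show ?thesis
      by (simp add: boost_def)
  qed
  with assms show ?thesis by (simp add: lie_bracket_def vec_eq_iff forall_3)
qed

context e11_coframe
begin

lemma W_boost: "W (s + t) *v boost s x = W t *v x"
proof -
  have uv: "u (s + t) * cosh s + v (s + t) * sinh s = u t" "u (s + t) * sinh s + v (s + t) * cosh s = v t"
  proof -
    have "(cosh s)\<^sup>2 - (sinh s)\<^sup>2 = 1" by (rule hyperbolic_pythagoras)
    then show "u (s + t) * cosh s + v (s + t) * sinh s = u t"
      "u (s + t) * sinh s + v (s + t) * cosh s = v t"
      unfolding u_def v_def cosh_add sinh_add by algebra+
  qed
  show ?thesis
    unfolding W_def
    by (simp add: boost_def matrix_vector_mult_def vec_eq_iff forall_3 sum_3 flip: uv)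
      (simp add: algebra_simps)
qed

lemma W_boost_0: "W s *v boost s x = W 0 *v x"
  using W_boost[of s 0] by simp

lemma W_E_vector [simp]: "W s *v (E s *v x) = x" "E s *v (W s *v x) = x"
  by (simp_all add: matrix_vector_mul_assoc W_E E_W)

text \<open>Constant components in the orthonormal frame: this identifies the Lie algebra with
  \<open>real^3\<close>.\<close>

definition field :: "real^3 \<Rightarrow> 3 vector_field" where
  "field \<xi> p = E (p$3) *v \<xi>"

lemma lie_algebra_eq: "lie_algebra e11_mult = range field"
proof -
  have "X = field (W 0 *v X 0)" if "X \<in> lie_algebra e11_mult" for X
  proof
    fix p
    have "X p = boost (p$3) (X 0)" using that unfolding lie_algebra_e11 by blast
    then have "field (W 0 *v X 0) p = E (p$3) *v (W (p$3) *v X p)"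
      by (simp only: field_def W_boost_0)
    then show "X p = field (W 0 *v X 0) p" by simp
  qed
  moreover have "field \<xi> \<in> lie_algebra e11_mult" for \<xi>
    unfolding lie_algebra_e11
  proof
    fix p
    have "field \<xi> p = E (p$3) *v (W 0 *v (E 0 *v \<xi>))" by (simp add: field_def)
    also have "\<dots> = E (p$3) *v (W (p$3) *v boost (p$3) (E 0 *v \<xi>))" by (simp only: W_boost_0)
    finally show "field \<xi> p = boost (p$3) (field \<xi> 0)" by (simp add: field_def)
  qed
  ultimately show ?thesis by blast
qed

lemma field_inject [simp]: "field \<xi> = field \<eta> \<longleftrightarrow> \<xi> = \<eta>"
  by (metis field_def W_E_vector(1))

text \<open>Structure constants of the orthonormal frame \<open>e 1 / \<alpha>\<close>,
  \<open>e 2 / \<beta>\<close>, \<open>e 3\<close>.\<close>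

definition bracket :: "real^3 \<Rightarrow> real^3 \<Rightarrow> real^3" where
  "bracket \<xi> \<eta> = vector [\<alpha> / \<beta> * (\<xi>$2 * \<eta>$3 - \<xi>$3 * \<eta>$2), 0, (\<xi>$2 * \<eta>$1 - \<xi>$1 * \<eta>$2) / (\<alpha> * \<beta>)]"

text \<open>Along \<open>field \<xi>\<close> the height changes at rate
  \<open>c / \<beta> * \<xi>$2\<close>, and \<open>E' = - E K\<close>, so the constant matrix
  \<open>K\<close> determines the bracket.\<close>

lemma lie_bracket_field: "lie_bracket (field \<xi>) (field \<eta>) = field (bracket \<xi> \<eta>)"
proof
  fix p
  have D: "frechet_derivative (field \<xi>) (at p) = (\<lambda>h. h$3 *\<^sub>R - (E (p$3) *v (K *v \<xi>)))" for \<xi>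
  proof -
    have deriv: "((\<lambda>s. E s *v \<xi>) has_vector_derivative (- (E (p$3) ** K)) *v \<xi>) (at (p$3))"
      by (rule bounded_linear.has_vector_derivative[OF _ E_deriv])
        (simp add: linear_conv_bounded_linear[symmetric] linear_iff matrix_vector_mult_add_rdistrib
          scaleR_matrix_vector_assoc)
    have "(- (E (p$3) ** K)) *v \<xi> = - (E (p$3) *v (K *v \<xi>))"
      unfolding matrix_vector_mul_assoc by (simp add: matrix_vector_mult_def vec_eq_iff sum_negf)
    then show ?thesis
      using frechet_derivative_height[OF deriv] unfolding field_def[abs_def] by simp
  qed
  have height: "field \<xi> p $ 3 = c / \<beta> * \<xi>$2" for \<xi>
    by (simp add: field_def E_def matrix_vector_mult_def sum_3)
  have "lie_bracket (field \<xi>) (field \<eta>) p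
      = E (p$3) *v (- (c / \<beta>) *\<^sub>R (K *v (\<xi>$2 *\<^sub>R \<eta> - \<eta>$2 *\<^sub>R \<xi>)))"
    by (simp add: lie_bracket_def D height algebra_simps)
  also have "- (c / \<beta>) *\<^sub>R (K *v (\<xi>$2 *\<^sub>R \<eta> - \<eta>$2 *\<^sub>R \<xi>)) = bracket \<xi> \<eta>"
    using pos by (simp add: vec_eq_iff forall_3 K_def bracket_def matrix_vector_mult_def sum_3
        algebra_simps diff_divide_distrib sign_cancel)
  finally show "lie_bracket (field \<xi>) (field \<eta>) p = field (bracket \<xi> \<eta>) p"
    by (simp only: field_def[of "bracket _ _"])
qed

lemma derivation_diagonal:
  assumes D: "\<And>\<xi>. D (field \<xi>) = field (d * \<xi>)"
  shows "derivation e11_mult D \<longleftrightarrow> d$2 = 0 \<and> d$1 = d$3"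
proof -
  have comb: "(\<lambda>p. a *\<^sub>R field \<xi> p + b *\<^sub>R field \<eta> p) = field (a *\<^sub>R \<xi> + b *\<^sub>R \<eta>)" for a b \<xi> \<eta>
    by (simp add: fun_eq_iff field_def algebra_simps)
  have lin: "d * (a *\<^sub>R \<xi> + b *\<^sub>R \<eta>) = a *\<^sub>R (d * \<xi>) + b *\<^sub>R (d * \<eta>)" for a b \<xi> \<eta>
    by (simp add: algebra_simps)
  have "derivation e11_mult D \<longleftrightarrow>
      (\<forall>\<xi> \<eta>. d * bracket \<xi> \<eta> = bracket (d * \<xi>) \<eta> + bracket \<xi> (d * \<eta>))"
    \<comment> \<open>The Leibniz clause has a sum without scalars, hence the instance with both
      coefficients 1.\<close>
    using comb[of 1 _ 1]
    by (simp add: derivation_def lie_algebra_eq D comb lin lie_bracket_field)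
  also have "\<dots> \<longleftrightarrow> d$2 = 0 \<and> d$1 = d$3"
  proof
    assume *: "\<forall>\<xi> \<eta>. d * bracket \<xi> \<eta> = bracket (d * \<xi>) \<eta> + bracket \<xi> (d * \<eta>)"
    \<comment> \<open>Up to order these are the only basis pairs with nonzero bracket; adding the
      two resulting equations forces \<open>d$2 = 0\<close>.\<close>
    from *[rule_format, of "axis 2 1" "axis 3 1"] *[rule_format, of "axis 2 1" "axis 1 1"]
    have "d$1 = d$2 + d$3" "d$3 = d$2 + d$1" using pos
      by (simp_all add: bracket_def axis_def vec_eq_iff forall_3 field_simps)
    then show "d$2 = 0 \<and> d$1 = d$3" by simp
  qed (use pos in \<open>simp add: bracket_def vec_eq_iff forall_3 field_simps\<close>)
  finally show ?thesis .
qed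

end

section \<open>The soliton equation\<close>

context e11_metric
begin

lemma metric_left_invariant: "left_invariant_metric e11_mult g"
proof -
  have "bilinear (g p)" for p
    unfolding bilinear_def g
    by (intro conjI allI linearI) (simp_all add: algebra_simps)
  moreover have "g p x x > 0" if "x \<noteq> 0" for p x
  proof -
    have "W (p$3) *v x \<noteq> 0" using that W_E_vector(2)[of "p$3" x] by force
    then show ?thesis by (simp add: g)
  qed
  ultimately show ?thesis
    by (simp add: left_invariant_metric_def riemannian_metric_def frechet_derivative_e11_mult g W_boost
        inner_commute)
qed

lemma cross_curvature_metric:
  "cross_curvature g p x y
    = (\<Sum>l\<in>UNIV. sect$(l+1) * sect$(l+2) * (W (p$3) *v x)$l * (W (p$3) *v y)$l)"
proof -
  interpret diagonal_curvature g p "W (p$3)" "E (p$3)" sect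
    by unfold_locales (rule g curvature_cross W_E)+
  show ?thesis by (simp add: cross_curvature_diagonal cross_form_def)
qed

definition h :: "real^3" where "h = (\<chi> l. sect$(l+1) * sect$(l+2))"

text \<open>The factor \<open>\<epsilon>\<close> serves both signs of the flow. Testing against
  \<open>E z\<close> for all \<open>z\<close> gives the uniqueness required by
  \<open>THE\<close>.\<close>

lemma metric_endomorphism_field:
  assumes H: "\<And>p x y. H p x y = \<epsilon> * cross_curvature g p x y"
  shows "metric_endomorphism g H (field \<xi>) p = field (\<epsilon> *\<^sub>R (h * \<xi>)) p"
  unfolding metric_endomorphism_def
proof (rule the_equality)
  have HF: "H p (field \<xi> p) y = (\<epsilon> *\<^sub>R (h * \<xi>)) \<bullet> (W (p$3) *v y)" for y
    by (simp add: H cross_curvature_metric field_def h_def inner_vec_def sum_distrib_left mult_ac)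
  show "\<forall>y. g p (field (\<epsilon> *\<^sub>R (h * \<xi>)) p) y = H p (field \<xi> p) y"
    unfolding HF by (simp add: g field_def)
  fix w assume w: "\<forall>y. g p w y = H p (field \<xi> p) y"
  have "(W (p$3) *v w) \<bullet> z = (\<epsilon> *\<^sub>R (h * \<xi>)) \<bullet> z" for z
    using w[rule_format, of "E (p$3) *v z"] unfolding HF by (simp add: g)
  then have "W (p$3) *v w = \<epsilon> *\<^sub>R (h * \<xi>)"
    by (metis vector_eq_rdot)
  then show "w = field (\<epsilon> *\<^sub>R (h * \<xi>)) p"
    by (metis field_def W_E_vector(2))
qed

lemma algebraic_soliton_iff:
  assumes H: "\<And>p x y. H g p x y = \<epsilon> * cross_curvature g p x y" and "\<epsilon> \<noteq> 0"
  shows "algebraic_soliton e11_mult H g q \<longleftrightarrow> \<alpha> = 1 \<and> q = \<epsilon> / \<beta> ^ 4"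
proof -
  have "(\<lambda>p. metric_endomorphism g (H g) (field \<xi>) p - q *\<^sub>R field \<xi> p)
      = field ((\<epsilon> *\<^sub>R h - vec q) * \<xi>)" for \<xi>
  proof -
    have eq: "(\<epsilon> *\<^sub>R h - vec q) * \<xi> = \<epsilon> *\<^sub>R (h * \<xi>) - q *\<^sub>R \<xi>"
      by (simp add: vec_eq_iff algebra_simps)
    show ?thesis
      unfolding metric_endomorphism_field[OF H] eq
      by (simp add: fun_eq_iff field_def matrix_vector_mult_diff_distrib matrix_vector_mult_scaleR)
  qed
  from derivation_diagonal[OF this] have "algebraic_soliton e11_mult H g q
      \<longleftrightarrow> \<epsilon> * h$2 = q \<and> h$1 = h$3"
    using \<open>\<epsilon> \<noteq> 0\<close> by (simp add: algebraic_soliton_def metric_left_invariant)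
  also have "h$1 = h$3 \<longleftrightarrow> sect$1 = sect$3"
  proof -
    have "\<alpha>\<^sup>2 + 1 > 0" by (intro add_nonneg_pos) simp_all
    then have "sect$2 > 0" using pos by (simp add: sect_def)
    then show ?thesis by (auto simp: h_def)
  qed
  also have "sect$1 = sect$3 \<longleftrightarrow> \<alpha> = 1"
  proof -
    have "sect$1 - sect$3 = (\<alpha>\<^sup>2 + 1) * (1 - \<alpha>\<^sup>2) / (\<alpha>\<^sup>2 * \<beta>\<^sup>2)"
      using pos by (simp add: sect_def field_simps)
    moreover have "\<alpha>\<^sup>2 + 1 > 0" by (intro add_nonneg_pos) simp_all
    ultimately have "sect$1 = sect$3 \<longleftrightarrow> \<alpha>\<^sup>2 = 1" using pos by auto
    then show ?thesis using pos by (auto simp: power2_eq_1_iff)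
  qed
  \<comment> \<open>At \<open>\<alpha> = 1\<close> both \<open>sect$1\<close> and
    \<open>sect$3\<close> are \<open>- 1 / \<beta>\<^sup>2\<close>, so \<open>h$2\<close> is
    \<open>1 / \<beta> ^ 4\<close>.\<close>
  also have "\<epsilon> * h$2 = q \<and> \<alpha> = 1 \<longleftrightarrow> \<alpha> = 1 \<and> q = \<epsilon> / \<beta> ^ 4"
    by (auto simp: h_def sect_def power2_eq_square power4_eq_xxxx)
  finally show ?thesis .
qed

end

section \<open>Normal form of the frames with the prescribed brackets\<close>

lemma e11_metric_of_frame:
  fixes e :: "3 \<Rightarrow> 3 vector_field" and A B :: real
  assumes frame: "left_invariant_frame e11_mult e"
    and br: "lie_bracket (e 2) (e 3) = e 1" "lie_bracket (e 1) (e 2) = (\<lambda>p. - e 3 p)"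
    and dual: "dual_coframe e \<omega>"
    and pos: "A > 0" "B > 0"
    and g: "g = (\<lambda>p u v. A * (\<omega> 1 p u * \<omega> 1 p v) + B * (\<omega> 2 p u * \<omega> 2 p v) + \<omega> 3 p u * \<omega> 3 p v)"
  obtains c u0 v0 k l where "e11_metric (sqrt A) (sqrt B) c u0 v0 k l g"
proof -
  define c m n a b where "c = e 2 0 $ 3" and "m = e 1 0 $ 1" and "n = e 1 0 $ 2"
    and "a = e 2 0 $ 1" and "b = e 2 0 $ 2"
  have inv: "e i \<in> lie_algebra e11_mult" for i
    using frame by (simp add: left_invariant_frame_def)
  have ind: "inj (\<lambda>i. e i 0)" "independent (range (\<lambda>i. e i 0))"
    using frame by (simp_all add: left_invariant_frame_def)
  have b1: "e 1 0 = vector [c * e 3 0$2 - e 3 0$3 * b, c * e 3 0$1 - e 3 0$3 * a, 0]"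
    using lie_bracket_e11[OF inv inv, of 2 3] br(1) by (simp add: a_def b_def c_def)
  have "- e 3 0 = vector [e 1 0$3 * b - c * n, e 1 0$3 * a - c * m, 0]"
    using lie_bracket_e11[OF inv inv, of 1 2] br(2) by (simp add: a_def b_def c_def m_def n_def)
  then have b3: "e 3 0 = - vector [e 1 0$3 * b - c * n, e 1 0$3 * a - c * m, 0]"
    by (metis minus_minus)
  \<comment> \<open>Both vectors are brackets up to sign, and brackets lie in the translation
    plane.\<close>
  have z: "e 1 0$3 = 0" "e 3 0$3 = 0"
    by (subst b1, simp) (subst b3, simp)
  have "m = c * e 3 0$2" "n = c * e 3 0$1" "e 3 0$1 = c * n" "e 3 0$2 = c * m"
    unfolding m_def n_def using b1 b3 z by (simp_all only: vec_eq_iff forall_3) (simp_all add: m_def n_def)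
  note e13 = z this
  have e1: "e 1 0 = vector [m, n, 0]" and e2: "e 2 0 = vector [a, b, c]" and e3: "e 3 0 = vector [c * n, c * m, 0]"
    using e13 by (simp_all add: vec_eq_iff forall_3 c_def m_def n_def a_def b_def)
  have "e 1 0 \<noteq> 0" using ind(2) dependent_zero by (metis rangeI)
  then have mn: "m \<noteq> 0 \<or> n \<noteq> 0" by (simp add: e1 vec_eq_iff forall_3)
  \<comment> \<open>Substituting the two bracket relations into each other; since
    \<open>e 1 0\<close> is nonzero, \<open>c\<close> is a sign.\<close>
  have "m = c * c * m" "n = c * c * n"
    using e13(3-6) by (simp_all only: mult.assoc)
  then have sign: "c * c = 1" using mn by auto
  have disc: "m\<^sup>2 \<noteq> n\<^sup>2"
  proof
    assume "m\<^sup>2 = n\<^sup>2"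
    then have "m = n \<or> m = - n" by (simp add: power2_eq_iff)
    then have "e 3 0 = c *\<^sub>R e 1 0 \<or> e 3 0 = (- c) *\<^sub>R e 1 0"
      by (auto simp: e1 e3 vec_eq_iff forall_3)
    moreover have "e 1 0 \<noteq> e 3 0" using injD[OF ind(1), of 1 3] by auto
    then have "e 1 0 \<in> span (range (\<lambda>i. e i 0) - {e 3 0})"
      by (intro span_base) auto
    ultimately have "e 3 0 \<in> span (range (\<lambda>i. e i 0) - {e 3 0})"
      using span_mul[of "e 1 0" _ c] span_mul[of "e 1 0" _ "- c"] by metis
    then show False using ind(2) by (auto simp: dependent_def)
  qed
  \<comment> \<open>The covector \<open>(u0, v0, k)\<close> is 1 on \<open>e 1 0\<close> and 0 on
    \<open>e 3 0\<close>; \<open>k\<close> and \<open>l\<close> are chosen so that the first and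
    third rows of \<open>W 0\<close> vanish on \<open>e 2 0\<close>.\<close>
  define \<Delta> u0 v0 k l where "\<Delta> = m\<^sup>2 - n\<^sup>2" and "u0 = m / \<Delta>" and "v0 = - n / \<Delta>"
    and "k = - c * (u0 * a + v0 * b)" and "l = - (v0 * a + u0 * b)"
  have \<Delta>: "\<Delta> \<noteq> 0" using disc by (simp add: \<Delta>_def)
  have uv: "u0 * m + v0 * n = 1"
    using \<Delta> by (simp add: u0_def v0_def divide_simps) (simp add: \<Delta>_def power2_eq_square)
  have "u0\<^sup>2 - v0\<^sup>2 = 1 / \<Delta>"
    using \<Delta> by (simp add: u0_def v0_def field_simps) (simp add: \<Delta>_def power2_eq_square algebra_simps)
  then have "u0\<^sup>2 \<noteq> v0\<^sup>2" using \<Delta> by auto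
  then interpret e11_coframe "sqrt A" "sqrt B" c u0 v0 k l
    using pos sign by unfold_locales auto
  have uv': "v0 * m + u0 * n = 0" by (simp add: u0_def v0_def)
  have kl: "u0 * a + v0 * b + k * c = 0" "v0 * a + u0 * b + l = 0"
    using sign unfolding k_def l_def by (algebra, simp)
  have W0: "W 0 = vector [vector [sqrt A * u0, sqrt A * v0, sqrt A * k], vector [0, 0, sqrt B * c],
      vector [c * v0, c * u0, l]]"
    by (simp add: W_def u_def v_def)
  have We0: "W 0 *v e 1 0 = vector [sqrt A, 0, 0]" "W 0 *v e 2 0 = vector [0, sqrt B, 0]"
    "W 0 *v e 3 0 = vector [0, 0, 1]"
    unfolding W0 e1 e2 e3 vec_eq_iff forall_3 matrix_vector_mult_def
    by (simp add: sum_3; (intro conjI)?; use uv uv' kl sign in algebra)+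
  have We: "W (p$3) *v e i p = W 0 *v e i 0" for p i
  proof -
    have "e i p = boost (p$3) (e i 0)" using inv[of i] unfolding lie_algebra_e11 by blast
    then show ?thesis by (simp only: W_boost_0)
  qed
  have W: "W (p$3) *v x = vector [sqrt A * \<omega> 1 p x, sqrt B * \<omega> 2 p x, \<omega> 3 p x]" for p x
  proof -
    let ?\<xi> = "W (p$3) *v x"
    \<comment> \<open>The vector with frame coefficients read off from \<open>W x\<close>; it turns
      out to be \<open>x\<close>, which identifies the rows of \<open>W\<close> with the rescaled
      coframe.\<close>
    define y where "y = (?\<xi>$1 / sqrt A) *\<^sub>R e 1 p + (?\<xi>$2 / sqrt B) *\<^sub>R e 2 p + ?\<xi>$3 *\<^sub>R e 3 p"
    have "W (p$3) *v y = ?\<xi>"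
      using pos by (simp add: y_def algebra_simps We We0)
        (simp add: vec_eq_iff forall_3)
    then have "x = y" by (metis W_E_vector(2))
    then have "\<omega> i p x = \<omega> i p y" for i by (rule arg_cong)
    moreover have "\<omega> i p y = ?\<xi>$1 / sqrt A * (if i = 1 then 1 else 0)
        + ?\<xi>$2 / sqrt B * (if i = 2 then 1 else 0) + ?\<xi>$3 * (if i = 3 then 1 else 0)" for i
      using dual by (simp add: dual_coframe_def y_def linear_add linear_scale)
    ultimately show ?thesis using pos by (simp add: vec_eq_iff[of ?\<xi>] forall_3)
  qed
  have sqrt_mult_sqrt: "sqrt t * x * (sqrt t * y) = t * (x * y)" if "t > 0" for t x y
  proof -
    have "sqrt t * x * (sqrt t * y) = (sqrt t * sqrt t) * (x * y)" by (simp only: mult_ac)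
    then show ?thesis using that by simp
  qed
  have "g p x y = (W (p$3) *v x) \<bullet> (W (p$3) *v y)" for p x y
    using pos by (simp add: g W inner_vec_def sum_3 sqrt_mult_sqrt)
  then have "e11_metric (sqrt A) (sqrt B) c u0 v0 k l g"
    by unfold_locales
  then show ?thesis by (rule that)
qed

theorem theorem3p8:
  fixes e :: "3 \<Rightarrow> 3 vector_field"
    and \<omega> :: "3 \<Rightarrow> real^3 \<Rightarrow> real^3 \<Rightarrow> real"
    and g :: "3 tensor2"
    and A B \<kappa> :: real
  assumes "left_invariant_frame e11_mult e"
    and "lie_bracket (e 2) (e 3) = e 1"
    and "lie_bracket (e 1) (e 2) = (\<lambda>p. - e 3 p)"
    and "lie_bracket (e 3) (e 1) = (\<lambda>p. 0)"
    and "dual_coframe e \<omega>"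
    and "A > 0" and "B > 0"
    and "g = (\<lambda>p u v. A * (\<omega> 1 p u * \<omega> 1 p v) + B * (\<omega> 2 p u * \<omega> 2 p v) + \<omega> 3 p u * \<omega> 3 p v)"
  shows "(expanding_algebraic_soliton e11_mult plus_XCF_tensor g \<kappa> \<longleftrightarrow> A = 1 \<and> \<kappa> = 1 / B\<^sup>2) \<and>
         (shrinking_algebraic_soliton e11_mult minus_XCF_tensor g \<kappa> \<longleftrightarrow> A = 1 \<and> \<kappa> = - 1 / B\<^sup>2)"
proof -
  obtain c u0 v0 k l where "e11_metric (sqrt A) (sqrt B) c u0 v0 k l g"
    by (rule e11_metric_of_frame[OF assms(1-3,5-8)])
  then interpret e11_metric "sqrt A" "sqrt B" c u0 v0 k l g .
  have B: "sqrt B ^ 4 = B\<^sup>2"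
    using \<open>B > 0\<close> power_mult[of "sqrt B" 2 2] by simp
  have "algebraic_soliton e11_mult plus_XCF_tensor g \<kappa> \<longleftrightarrow> A = 1 \<and> \<kappa> = 1 / B\<^sup>2"
    using algebraic_soliton_iff[of plus_XCF_tensor 1 \<kappa>] by (simp add: plus_XCF_tensor_def B)
  moreover have "algebraic_soliton e11_mult minus_XCF_tensor g \<kappa> \<longleftrightarrow> A = 1 \<and> \<kappa> = - 1 / B\<^sup>2"
    using algebraic_soliton_iff[of minus_XCF_tensor "-1" \<kappa>] by (simp add: minus_XCF_tensor_def B)
  \<comment> \<open>Since \<open>B > 0\<close>, the constants \<open>1 / B\<^sup>2\<close> and
    \<open>- 1 / B\<^sup>2\<close> already have the signs required for expanding and
    shrinking.\<close>
  ultimately show ?thesis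
    using \<open>B > 0\<close> by (auto simp: expanding_algebraic_soliton_def shrinking_algebraic_soliton_def)
qed

end
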